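(* Let $n\ge 1$ be an integer. The power series (in the variable $t$) for the function $L_n(t)=l_n(t)-l_n(t^q)$, that is, the series $$\frac{t^q}{[1]^n}+\sum_{j=2}^\infty\left(\frac{1}{[j]^n}-\frac{1}{[j-1]^n}\right)t^{q^j},$$ converges for all $t\in\overline{K}_c$ with $|t|<q^{1/q}$.
   Context: Let $\mathbb F_q$ be a finite field with $q$ elements and let $K=\mathbb F_q((x))$ be the field of formal Laurent series $z=\sum_{i=n}^\infty \zeta_i x^i$, $n\in\mathbb Z$, $\zeta_i\in\mathbb F_q$, with the non-Archimedean absolute value $|z|=q^{-n}$ if $\zeta_n\neq 0$ (so $|x|=q^{-1}$). Let $\overline{K}_c$ be the completion of an algebraic closure of $K$; the extension of the absolute value to $\overline{K}_c$ is also denoted $|\cdot|$. For $j\ge 1$ put $[j]=x^{q^j}-x$. The polylogarithms are the functions $l_n(t)=\sum_{j=1}^\infty \frac{t^{q^j}}{[j]^n}$, $n=1,2,\ldots$, whose series converge for $|t|<1$. *)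

theory Defs
  imports "HOL-Analysis.Analysis" "HOL-Algebra.Algebraic_Closure_Type"
begin

text \<open>
  Throughout, \<open>'a\<close> is a finite field with \<open>q = CARD('a)\<close> elements and \<open>K = 'a fls\<close>.
  The absolute value below is normalised by \<open>\<bar>x\<bar> = 1 / q\<close>; the library's metric on
  \<open>'a fls\<close> is a different one (it has \<open>2\<close> in place of \<open>q\<close>) and is not used.
\<close>

definition fls_abs :: "'a::{field,finite} fls \<Rightarrow> real" where
  "fls_abs z = (if z = 0 then 0 else real CARD('a) powi (- fls_subdegree z))"

definition nonarch_abs_value :: "('b::field \<Rightarrow> real) \<Rightarrow> bool" where
  "nonarch_abs_value v \<longleftrightarrow>
     (\<forall>a. 0 \<le> v a) \<and>
     (\<forall>a. v a = 0 \<longleftrightarrow> a = 0) \<and>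
     (\<forall>a b. v (a * b) = v a * v b) \<and>
     (\<forall>a b. v (a + b) \<le> max (v a) (v b))"

text \<open>
  The type \<open>'c\<close> with the absolute value \<open>vabs\<close> is a completion of the algebraic closure of \<open>K\<close>,
  with respect to the extension of \<open>fls_abs\<close>: a valued field, complete (by its sort) in the metric
  of \<open>vabs\<close>, containing the algebraic closure as a dense subfield via \<open>\<iota>\<close>. Such a field is unique
  up to an isometric isomorphism over \<open>K\<close>.
\<close>

locale completed_alg_closure =
  fixes \<iota> :: "'a::{field,finite} fls alg_closure \<Rightarrow> 'c::{field,complete_space}"
    and vabs :: "'c \<Rightarrow> real"
  assumes hom_one: "\<iota> 1 = 1"
    and hom_add: "\<iota> (a + b) = \<iota> a + \<iota> b"
    and hom_mult: "\<iota> (a * b) = \<iota> a * \<iota> b"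
    and vabs_nonarch: "nonarch_abs_value vabs"
    and dist_vabs: "dist u w = vabs (u - w)"
    and vabs_extends: "vabs (\<iota> (to_ac z)) = fls_abs z"
    and dense_range: "closure (range \<iota>) = UNIV"

definition brack :: "nat \<Rightarrow> 'a::{field,finite} fls" where
  "brack j = fls_X ^ (CARD('a) ^ j) - fls_X"

text \<open>Series over \<open>j \<ge> 1\<close> are written as series over all naturals, with \<open>Suc j\<close> for \<open>j\<close>.\<close>

definition polylog ::
    "('a::{field,finite} fls alg_closure \<Rightarrow> 'c::{field,complete_space}) \<Rightarrow> nat \<Rightarrow> 'c \<Rightarrow> 'c" where
  "polylog \<iota> n t = (\<Sum>j. t ^ (CARD('a) ^ Suc j) / \<iota> (to_ac (brack (Suc j))) ^ n)"

definition L_fun ::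
    "('a::{field,finite} fls alg_closure \<Rightarrow> 'c::{field,complete_space}) \<Rightarrow> nat \<Rightarrow> 'c \<Rightarrow> 'c" where
  "L_fun \<iota> n t = polylog \<iota> n t - polylog \<iota> n (t ^ CARD('a))"

text \<open>The coefficient of \<open>t ^ (q ^ j)\<close> in the power series of \<open>L_fun\<close>, for \<open>j \<ge> 1\<close>.\<close>

definition L_coeff ::
    "('a::{field,finite} fls alg_closure \<Rightarrow> 'c::{field,complete_space}) \<Rightarrow> nat \<Rightarrow> nat \<Rightarrow> 'c" where
  "L_coeff \<iota> n j =
     (if j = 1 then 1 / \<iota> (to_ac (brack 1)) ^ n
      else 1 / \<iota> (to_ac (brack j)) ^ n - 1 / \<iota> (to_ac (brack (j - 1))) ^ n)"

end

theory Submission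
  imports Defs
begin

text \<open>
  In a complete non-Archimedean field a series converges as soon as its terms tend to zero
  (\<open>nonarch_field.summable_if_terms_vanish\<close>), so everything reduces to the size of the coefficients.

  Every \<open>[j]\<close> with \<open>j \<ge> 1\<close> has absolute value \<open>1 / q\<close>, because \<open>x\<close> is its lowest term. Thus the
  coefficients of the polylogarithm are bounded, which gives only \<open>\<bar>t\<bar> < 1\<close>. In the difference
  \<open>[j]\<^sup>-\<^sup>n - [j-1]\<^sup>-\<^sup>n\<close>, however, the terms \<open>x\<close> cancel: \<open>[j] - [j-1] = x ^ q ^ j - x ^ q ^ (j-1)\<close> has
  absolute value \<open>q\<close> to the power \<open>- q ^ (j-1)\<close>. Since \<open>a\<^sup>-\<^sup>n - b\<^sup>-\<^sup>n\<close> is divisible by \<open>b - a\<close> with a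
  bounded cofactor when \<open>\<bar>a\<bar> = \<bar>b\<bar>\<close> is fixed, the coefficient of \<open>t ^ q ^ j\<close> is as small up to a
  constant, and the corresponding term is at most a constant times \<open>(\<bar>t\<bar> ^ q / q) ^ q ^ (j-1)\<close>.
  This tends to zero exactly when \<open>\<bar>t\<bar> ^ q < q\<close>.

  For \<open>\<bar>t\<bar> < 1\<close> the partial sums of the series are differences of partial sums of the two
  polylogarithms, with the second one truncated one step earlier, and both converge.
\<close>

section \<open>Series in complete non-Archimedean fields\<close>

text \<open>
  The type class of the field provides no compatibility between metric and arithmetic; all of it
  comes from the metric being induced by the absolute value.
\<close>

locale nonarch_field =
  fixes v :: "'c::{field,complete_space} \<Rightarrow> real"
  assumes nonarch: "nonarch_abs_value v"
    and dist_eq: "dist u w = v (u - w)"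
begin

lemma v_nonneg [simp]: "0 \<le> v a"
  and v_eq_0_iff [simp]: "v a = 0 \<longleftrightarrow> a = 0"
  and v_mult: "v (a * b) = v a * v b"
  and v_add: "v (a + b) \<le> max (v a) (v b)"
  using nonarch by (auto simp: nonarch_abs_value_def)

lemma v_0 [simp]: "v 0 = 0"
  by simp

lemma v_1 [simp]: "v 1 = 1"
  using v_mult[of 1 1] by simp

lemma v_power: "v (a ^ k) = v a ^ k"
  by (induction k) (auto simp: v_mult)

lemma v_minus [simp]: "v (- a) = v a"
proof -
  have "v (- a) ^ 2 = v a ^ 2"
    using v_power[of "- a" 2] v_power[of a 2] by simp
  then show ?thesis
    by simp
qed

lemma v_diff: "v (a - b) \<le> max (v a) (v b)"
  using v_add[of a "- b"] by simp

lemma v_divide: "v (a / b) = v a / v b"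
proof (cases "b = 0")
  case False
  then have "v (a / b) * v b = v a"
    using v_mult[of "a / b" b] by simp
  with False show ?thesis
    by (simp add: field_simps)
qed simp

lemma v_sum_le:
  assumes "finite A" "0 \<le> e" "\<And>i. i \<in> A \<Longrightarrow> v (f i) \<le> e"
  shows "v (sum f A) \<le> e"
  using assms
proof (induction A rule: finite_induct)
  case (insert i A)
  then show ?case
    using v_add[of "f i" "sum f A"] by fastforce
qed simp

text \<open>The ultrametric inequality bounds a whole tail segment by its largest term.\<close>

lemma summable_if_terms_vanish:
  assumes "(\<lambda>j. v (f j)) \<longlonglongrightarrow> 0"
  shows "summable f"
proof -
  have "Cauchy (\<lambda>k. \<Sum>j<k. f j)"
    unfolding Cauchy_altdef
  proof (intro allI impI)
    fix e :: real
    assume e: "e > 0"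
    then have "eventually (\<lambda>j. v (f j) < e / 2) sequentially"
      using order_tendstoD(2)[OF assms, of "e / 2"] by simp
    then obtain M where M: "\<And>j. j \<ge> M \<Longrightarrow> v (f j) < e / 2"
      by (auto simp: eventually_sequentially)
    have "dist (\<Sum>j<m. f j) (\<Sum>j<k. f j) < e" if "m \<ge> M" "k > m" for m k
    proof -
      have "{..<k} = {..<m} \<union> {m..<k}"
        using that by auto
      then have split: "(\<Sum>j<k. f j) = (\<Sum>j<m. f j) + (\<Sum>j=m..<k. f j)"
        by (simp add: sum.union_disjoint ivl_disj_int)
      have "v (\<Sum>j=m..<k. f j) \<le> e / 2"
        using e M that by (intro v_sum_le) (auto intro: less_imp_le)
      then have "dist (\<Sum>j<k. f j) (\<Sum>j<m. f j) < e"
        using e by (simp add: dist_eq split)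
      then show ?thesis
        by (simp add: dist_commute)
    qed
    then show "\<exists>M. \<forall>m\<ge>M. \<forall>k>m. dist (\<Sum>j<m. f j) (\<Sum>j<k. f j) < e"
      by blast
  qed
  then show ?thesis
    by (simp add: summable_iff_convergent Cauchy_convergent_iff)
qed

lemma v_tendsto_0:
  assumes "\<forall>\<^sub>F j in sequentially. v (f j) \<le> g j" "g \<longlonglongrightarrow> 0"
  shows "(\<lambda>j. v (f j)) \<longlonglongrightarrow> 0"
  using assms by (intro Lim_null_comparison[of "\<lambda>j. v (f j)" g]) simp_all

lemma tendsto_iff_v:
  fixes f :: "nat \<Rightarrow> 'c"
  shows "f \<longlonglongrightarrow> a \<longleftrightarrow> (\<lambda>k. v (f k - a)) \<longlonglongrightarrow> 0"
  by (subst tendsto_dist_iff) (simp add: dist_eq)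

lemma tendsto_diff_nonarch:
  fixes f g :: "nat \<Rightarrow> 'c"
  assumes "f \<longlonglongrightarrow> a" "g \<longlonglongrightarrow> b"
  shows "(\<lambda>k. f k - g k) \<longlonglongrightarrow> a - b"
proof -
  have "(\<lambda>k. max (v (f k - a)) (v (g k - b))) \<longlonglongrightarrow> max 0 0"
    using assms by (intro tendsto_max) (simp_all add: tendsto_iff_v)
  moreover have "v ((f k - g k) - (a - b)) \<le> max (v (f k - a)) (v (g k - b))" for k
    using v_diff[of "f k - a" "g k - b"] by (simp add: algebra_simps)
  ultimately show ?thesis
    unfolding tendsto_iff_v by (intro v_tendsto_0 always_eventually allI) (simp_all only: max.idem)
qed

lemma v_power_diff_le:
  assumes "v a \<le> r" "v b \<le> r"
  shows "v (a ^ k - b ^ k) \<le> v (a - b) * r ^ (k - 1)"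
proof -
  have r: "0 \<le> r"
    using assms(1) v_nonneg[of a] by linarith
  have "v (b ^ (k - Suc i) * a ^ i) \<le> r ^ (k - 1)" if "i < k" for i
  proof -
    have "v (b ^ (k - Suc i) * a ^ i) \<le> r ^ (k - Suc i) * r ^ i"
      unfolding v_mult v_power using assms r by (intro mult_mono power_mono) auto
    also have "\<dots> = r ^ (k - 1)"
      using that by (simp flip: power_add)
    finally show ?thesis .
  qed
  then have "v (\<Sum>i<k. b ^ (k - Suc i) * a ^ i) \<le> r ^ (k - 1)"
    using r by (intro v_sum_le) auto
  then show ?thesis
    by (simp add: power_diff_sumr2 v_mult mult_left_mono)
qed

text \<open>
  Passing from two elements of the same absolute value \<open>r\<close> to their inverses multiplies their
  distance by the constant \<open>1 / r\<^sup>2\<close>.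
\<close>

lemma v_inverse_power_diff_le:
  assumes "v a = r" "v b = r" "r > 0" "k \<ge> 1"
  shows "v (1 / a ^ k - 1 / b ^ k) \<le> v (a - b) * (1 / r) ^ (k + 1)"
proof -
  have nz: "a \<noteq> 0" "b \<noteq> 0"
    by (metis assms(1,3) v_0 less_irrefl, metis assms(2,3) v_0 less_irrefl)
  have "1 / a - 1 / b = - (a - b) / (a * b)"
    using nz by (simp add: field_simps)
  then have dist_inv: "v (1 / a - 1 / b) = v (a - b) * (1 / r) ^ 2"
    using assms by (simp add: v_divide v_mult power2_eq_square del: minus_diff_eq)
  have "v (1 / a ^ k - 1 / b ^ k) = v ((1 / a) ^ k - (1 / b) ^ k)"
    by (simp add: power_one_over)
  also have "\<dots> \<le> v (1 / a - 1 / b) * (1 / r) ^ (k - 1)"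
    using assms by (intro v_power_diff_le) (simp_all add: v_divide)
  also have "\<dots> = v (a - b) * (1 / r) ^ (2 + (k - 1))"
    by (simp only: dist_inv power_add mult.assoc)
  also have "2 + (k - 1) = k + 1"
    using assms by simp
  finally show ?thesis .
qed

end

section \<open>Absolute values of the elements [j]\<close>

lemma card_field_ge_2: "CARD('a::{field,finite}) \<ge> 2"
proof -
  have "card {0, 1 :: 'a} \<le> CARD('a)"
    by (rule card_mono) auto
  then show ?thesis
    by simp
qed

lemma fls_abs_X_power_diff:
  assumes "k < m"
  shows "fls_abs (fls_X ^ m - fls_X ^ k :: 'a::{field,finite} fls) = (1 / real CARD('a)) ^ k"
proof -
  let ?f = "fls_X ^ m - fls_X ^ k :: 'a fls"
  have "fls_nth ?f (int k) \<noteq> 0"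
    using assms by simp
  then have "?f \<noteq> 0"
    by fastforce
  moreover have "fls_subdegree ?f = int k"
    using assms by (intro fls_subdegree_eqI) auto
  ultimately show ?thesis
    by (simp add: fls_abs_def power_int_minus power_one_over inverse_eq_divide)
qed

lemma fls_abs_brack:
  assumes "j \<ge> 1"
  shows "fls_abs (brack j :: 'a::{field,finite} fls) = 1 / real CARD('a)"
proof -
  have "1 < CARD('a) ^ j"
    using assms card_field_ge_2[where 'a = 'a] by (intro one_less_power) auto
  from fls_abs_X_power_diff[OF this, where 'a = 'a] show ?thesis
    by (simp add: brack_def)
qed

lemma fls_abs_brack_diff:
  "fls_abs (brack (Suc j) - brack j :: 'a::{field,finite} fls) = (1 / real CARD('a)) ^ (CARD('a) ^ j)"
proof -
  have "CARD('a) ^ j < CARD('a) ^ Suc j"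
    using card_field_ge_2[where 'a = 'a] by (intro power_strict_increasing) auto
  from fls_abs_X_power_diff[OF this, where 'a = 'a] show ?thesis
    by (simp add: brack_def)
qed

lemma tendsto_power_power_0:
  fixes s :: real
  assumes "0 \<le> s" "s < 1" "q \<ge> (2::nat)"
  shows "(\<lambda>j. s ^ (q ^ j)) \<longlonglongrightarrow> 0"
proof (rule tendsto_sandwich[OF _ _ tendsto_const])
  show "(\<lambda>j. s ^ j) \<longlonglongrightarrow> 0"
    using assms by (intro LIMSEQ_realpow_zero)
  have "j \<le> q ^ j" for j
    using assms by (intro less_imp_le power_gt_expt) auto
  then show "\<forall>\<^sub>F j in sequentially. s ^ (q ^ j) \<le> s ^ j"
    using assms by (intro always_eventually allI power_decreasing) auto
qed (use assms in auto)

section \<open>The series of the polylogarithm and of its difference\<close>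

context completed_alg_closure
begin

sublocale nonarch_field vabs
  by unfold_locales (fact vabs_nonarch dist_vabs)+

abbreviation br :: "nat \<Rightarrow> 'c" where
  "br j \<equiv> \<iota> (to_ac (brack j))"

lemma hom_diff: "\<iota> (a - b) = \<iota> a - \<iota> b"
  using hom_add[of "a - b" b] by (simp add: eq_diff_eq)

lemma vabs_br: "j \<ge> 1 \<Longrightarrow> vabs (br j) = 1 / real CARD('a)"
  by (simp add: vabs_extends fls_abs_brack)

lemma vabs_br_diff: "vabs (br (Suc j) - br j) = (1 / real CARD('a)) ^ (CARD('a) ^ j)"
  using vabs_extends[of "brack (Suc j) - brack j"] by (simp add: hom_diff fls_abs_brack_diff)

lemma summable_polylog:
  assumes "vabs t < 1"
  shows "summable (\<lambda>j. t ^ (CARD('a) ^ Suc j) / br (Suc j) ^ n)"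
proof (rule summable_if_terms_vanish)
  have "(\<lambda>j. vabs t ^ (CARD('a) ^ Suc j)) \<longlonglongrightarrow> 0"
    by (rule LIMSEQ_Suc, rule tendsto_power_power_0)
       (use assms card_field_ge_2[where 'a = 'a] in auto)
  then have "(\<lambda>j. vabs t ^ (CARD('a) ^ Suc j) * real CARD('a) ^ n) \<longlonglongrightarrow> 0"
    by (rule tendsto_mult_left_zero)
  then show "(\<lambda>j. vabs (t ^ (CARD('a) ^ Suc j) / br (Suc j) ^ n)) \<longlonglongrightarrow> 0"
    by (simp add: v_divide v_power vabs_br power_one_over)
qed

text \<open>
  The substitution of \<open>t ^ q\<close> for \<open>t\<close> shifts the exponents \<open>q ^ j\<close> by one, so the partial sum of the
  difference series has one term more from the first polylogarithm than from the second.
\<close>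

lemma partial_sum_L:
  "(\<Sum>j<Suc k. L_coeff \<iota> n (Suc j) * t ^ (CARD('a) ^ Suc j)) =
   (\<Sum>j<Suc k. t ^ (CARD('a) ^ Suc j) / br (Suc j) ^ n) -
   (\<Sum>j<k. (t ^ CARD('a)) ^ (CARD('a) ^ Suc j) / br (Suc j) ^ n)"
proof (induction k)
  case 0
  then show ?case
    by (simp add: L_coeff_def)
next
  case (Suc k)
  have "(t ^ CARD('a)) ^ (CARD('a) ^ Suc k) = t ^ (CARD('a) ^ Suc (Suc k))"
    by (simp flip: power_mult)
  then show ?case
    using Suc by (simp add: L_coeff_def left_diff_distrib del: power_Suc)
qed

lemma L_sums:
  assumes "vabs t < 1"
  shows "(\<lambda>j. L_coeff \<iota> n (Suc j) * t ^ (CARD('a) ^ Suc j)) sums L_fun \<iota> n t"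
proof -
  define P where "P = (\<lambda>s k. \<Sum>j<k. s ^ (CARD('a) ^ Suc j) / br (Suc j) ^ n)"
  have lim: "P s \<longlonglongrightarrow> polylog \<iota> n s" if "vabs s < 1" for s
    using summable_LIMSEQ[OF summable_polylog[OF that, of n]] by (simp add: P_def polylog_def)
  have "vabs (t ^ CARD('a)) < 1"
    using assms by (simp add: v_power power_less_one_iff)
  then have "(\<lambda>k. P t (Suc k) - P (t ^ CARD('a)) k) \<longlonglongrightarrow> L_fun \<iota> n t"
    unfolding L_fun_def by (intro tendsto_diff_nonarch LIMSEQ_Suc[OF lim] lim assms)
  then have "(\<lambda>k. \<Sum>j<Suc k. L_coeff \<iota> n (Suc j) * t ^ (CARD('a) ^ Suc j)) \<longlonglongrightarrow> L_fun \<iota> n t"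
    unfolding partial_sum_L P_def .
  then show ?thesis
    unfolding sums_def
    using filterlim_sequentially_Suc[of "\<lambda>k. \<Sum>j<k. L_coeff \<iota> n (Suc j) * t ^ (CARD('a) ^ Suc j)"]
    by blast
qed

lemma vabs_L_coeff_le:
  assumes "n \<ge> 1" "j \<ge> 1"
  shows "vabs (L_coeff \<iota> n (Suc j)) \<le> (1 / real CARD('a)) ^ (CARD('a) ^ j) * real CARD('a) ^ (n + 1)"
proof -
  have "vabs (1 / br (Suc j) ^ n - 1 / br j ^ n)
      \<le> vabs (br (Suc j) - br j) * (1 / (1 / real CARD('a))) ^ (n + 1)"
    using assms by (intro v_inverse_power_diff_le vabs_br) auto
  then show ?thesis
    using assms by (simp only: L_coeff_def vabs_br_diff) simp
qed

lemma L_summable: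
  assumes "n \<ge> 1" "vabs t ^ CARD('a) < real CARD('a)"
  shows "summable (\<lambda>j. L_coeff \<iota> n (Suc j) * t ^ (CARD('a) ^ Suc j))"
proof (rule summable_if_terms_vanish)
  let ?q = "CARD('a)"
  let ?f = "\<lambda>j. vabs (L_coeff \<iota> n (Suc j) * t ^ (?q ^ Suc j))"
  define s where "s = vabs t ^ ?q / real ?q"
  have s: "0 \<le> s" "s < 1"
    using assms by (auto simp: s_def)
  have bound: "?f j \<le> s ^ (?q ^ j) * real ?q ^ (n + 1)" if "j \<ge> 1" for j
  proof -
    have "?f j \<le> ((1 / real ?q) ^ (?q ^ j) * real ?q ^ (n + 1)) * vabs t ^ (?q ^ Suc j)"
      unfolding v_mult v_power by (intro mult_right_mono vabs_L_coeff_le assms that) simp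
    also have "\<dots> = s ^ (?q ^ j) * real ?q ^ (n + 1)"
      by (simp add: s_def power_divide flip: power_mult)
    finally show ?thesis .
  qed
  have "(\<lambda>j. s ^ (?q ^ j)) \<longlonglongrightarrow> 0"
    using s card_field_ge_2 by (rule tendsto_power_power_0)
  then have "(\<lambda>j. s ^ (?q ^ j) * real ?q ^ (n + 1)) \<longlonglongrightarrow> 0"
    by (rule tendsto_mult_left_zero)
  moreover have "\<forall>\<^sub>F j in sequentially. ?f j \<le> s ^ (?q ^ j) * real ?q ^ (n + 1)"
    using eventually_ge_at_top[of 1] by eventually_elim (rule bound)
  ultimately show "?f \<longlonglongrightarrow> 0"
    by (rule v_tendsto_0[rotated])
qed

end

section \<open>The radius of convergence\<close>

theorem proposition3:
  fixes \<iota> :: "'a::{field,finite} fls alg_closure \<Rightarrow> 'c::{field,complete_space}"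
    and vabs :: "'c \<Rightarrow> real"
    and n :: nat
  assumes "completed_alg_closure \<iota> vabs"
    and "n \<ge> 1"
  shows "(\<forall>t. vabs t < 1 \<longrightarrow>
            (\<lambda>j. L_coeff \<iota> n (Suc j) * t ^ (CARD('a) ^ Suc j)) sums L_fun \<iota> n t) \<and>
         (\<forall>t. vabs t < real CARD('a) powr (1 / real CARD('a)) \<longrightarrow>
            summable (\<lambda>j. L_coeff \<iota> n (Suc j) * t ^ (CARD('a) ^ Suc j)))"
proof -
  interpret completed_alg_closure \<iota> vabs
    by (fact assms(1))
  let ?q = "CARD('a)"
  have "vabs t ^ ?q < real ?q" if "vabs t < real ?q powr (1 / real ?q)" for t
  proof -
    have "vabs t ^ ?q < (real ?q powr (1 / real ?q)) ^ ?q"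
      using that by (intro power_strict_mono) auto
    also have "\<dots> = real ?q"
      by (simp add: powr_powr flip: powr_realpow')
    finally show ?thesis .
  qed
  then show ?thesis
    using L_sums L_summable[OF assms(2)] by blast
qed

end
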